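(* Let $A\in\mathbb{K}^{m\times p}$ and $B\in\mathbb{K}^{m\times q}$ be any matrices, and let $P=A(B^*A)^+B^*$. Then $P$ is a projection with $\operatorname{rank}P=\operatorname{rank}(B^*A)$, and \[\mathcal{C}(P)=\mathcal{C}(AA^*B),\qquad \mathcal{N}(P)=\mathcal{N}(A^*BB^* ).\]
   Context: $\mathbb{K}=\mathbb{R}$ or $\mathbb{K}=\mathbb{C}$; $M^*$ is the conjugate transpose and $M^+$ the Moore--Penrose pseudoinverse of a matrix $M$; $\mathcal{C}(M)$ is its column space (range) and $\mathcal{N}(M)$ its null space. A projection is a square matrix $P$ with $P^2=P$ (not necessarily Hermitian). *)

theory Defs
  imports
    "Jordan_Normal_Form.Schur_Decomposition"
    "Jordan_Normal_Form.Matrix_Kernel"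
    "Jordan_Normal_Form.DL_Rank"
begin

definition is_projection :: "'a :: semiring_0 mat \<Rightarrow> bool" where
  "is_projection P \<longleftrightarrow> square_mat P \<and> P * P = P"

text \<open>The four Penrose equations. The carrier condition is needed because matrices of
  incompatible dimensions can still be multiplied in this library.\<close>

definition is_pseudoinverse :: "'a :: conjugatable_field mat \<Rightarrow> 'a mat \<Rightarrow> bool" where
  "is_pseudoinverse M X \<longleftrightarrow>
     X \<in> carrier_mat (dim_col M) (dim_row M) \<and>
     M * X * M = M \<and>
     X * M * X = X \<and>
     mat_adjoint (M * X) = M * X \<and>
     mat_adjoint (X * M) = X * M"

text \<open>Over the reals (with trivial conjugation) and the complex numbers the Penrose equations
  have exactly one solution, so the description below is proper there.\<close>

definition pseudoinverse :: "'a :: conjugatable_field mat \<Rightarrow> 'a mat" where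
  "pseudoinverse M = (THE X. is_pseudoinverse M X)"

end

theory Submission
  imports Defs
begin

text \<open>Write \<open>M = B\<^sup>*A\<close> and \<open>X = M\<^sup>+\<close>, so that \<open>P = A X B\<^sup>*\<close>. Idempotence is
  \<open>X M X = X\<close> between an \<open>A\<close> and a \<open>B\<^sup>*\<close>. For the other claims each space is compared by writing
  each of two matrices as a multiple of the other.

  \<^item> Range: \<open>A A\<^sup>*B = A M\<^sup>*\<close>. Since \<open>X M\<close> is Hermitian, \<open>X = X M X = M\<^sup>*X\<^sup>*X\<close> and
    \<open>M\<^sup>* = X M M\<^sup>*\<close>, which gives \<open>P = (A M\<^sup>*) (X\<^sup>*X B\<^sup>*)\<close> and \<open>A M\<^sup>* = P (A M\<^sup>*)\<close>.
  \<^item> Kernel: \<open>A\<^sup>*B B\<^sup>* = M\<^sup>*B\<^sup>*\<close>. Since \<open>M X\<close> is Hermitian, \<open>X = X X\<^sup>*M\<^sup>*\<close> and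
    \<open>M\<^sup>* = M\<^sup>*M X\<close>, which gives \<open>P = (A X X\<^sup>*) (M\<^sup>*B\<^sup>*)\<close> and \<open>M\<^sup>*B\<^sup>* = (M\<^sup>*B\<^sup>*) P\<close>.
  \<^item> Rank: left multiplication by \<open>B\<^sup>*\<close> maps the range of \<open>P\<close> onto that of \<open>M\<close>, and
    left multiplication by \<open>A X\<close> maps the range of \<open>M\<close> onto that of \<open>P\<close>. A linear map does not
    raise the dimension.

  The pseudoinverse is introduced by a definite description, so its existence and uniqueness come
  first. Uniqueness is Penrose's computation. Existence is reduced to the existence of some \<open>G\<close> with
  \<open>N G N = N\<close> for \<open>N = M\<^sup>*M\<close>, which Gauss-Jordan elimination provides over any field; the
  cancellation law \<open>M\<^sup>*M Y = M\<^sup>*M Z \<Longrightarrow> M Y = M Z\<close> then turns \<open>G M\<^sup>*\<close> into an inner inverse of \<open>M\<close>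
  whose product with \<open>M\<close> is Hermitian. That law needs only that a sum of terms \<open>z * conjugate z\<close>
  vanishes just when every \<open>z\<close> does. The argument therefore runs over every
  \<^class>\<open>conjugatable_ordered_field\<close>, which covers the reals and the complex numbers at once.\<close>

section \<open>Conjugate transposes\<close>

text \<open>The dimensions of the factors occur here as equations between terms, so that the simplifier can
  check them without guessing the intermediate dimensions that carrier premises would leave open.\<close>

lemma mat_mult_assoc:
  fixes A B C :: "'a :: semiring_0 mat"
  assumes "dim_col A = dim_row B" "dim_col B = dim_row C"
  shows "A * B * C = A * (B * C)"
  by (rule assoc_mult_mat[of A "dim_row A" "dim_col A" B "dim_col B" C "dim_col C"])
    (use assms in auto)

lemma dim_mat_adjoint [simp]:
  "dim_row (mat_adjoint A) = dim_col A" "dim_col (mat_adjoint A) = dim_row A"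
  by (auto simp: mat_adjoint_def)

lemma mat_adjoint_carrier [simp]:
  "mat_adjoint A \<in> carrier_mat n m \<longleftrightarrow> A \<in> carrier_mat m n"
  by (metis carrier_matD carrier_matI dim_mat_adjoint)

lemma mat_adjoint_index:
  assumes "i < dim_col A" "j < dim_row A"
  shows "mat_adjoint A $$ (i, j) = conjugate (A $$ (j, i))"
  using assms by (simp add: mat_adjoint_def mat_of_rows_index)

lemma mat_adjoint_adjoint [simp]: "mat_adjoint (mat_adjoint A) = A"
  by (rule eq_matI) (auto simp: mat_adjoint_index)

lemma mat_adjoint_mult:
  assumes "dim_col A = dim_row B"
  shows "mat_adjoint (A * B) = mat_adjoint B * mat_adjoint A"
  by (rule eq_matI)
    (use assms in \<open>auto simp: mat_adjoint_index scalar_prod_def sum_conjugate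
       conjugate_dist_mul mult.commute intro!: sum.cong\<close>)

text \<open>The diagonal entries of \<open>A\<^sup>*A\<close> are the squared lengths of the columns of \<open>A\<close>.\<close>

lemma adjoint_mult_self_eq_0D:
  fixes A :: "'a :: conjugatable_ordered_field mat"
  assumes "mat_adjoint A * A = 0\<^sub>m (dim_col A) (dim_col A)"
  shows "A = 0\<^sub>m (dim_row A) (dim_col A)"
proof (rule eq_matI)
  fix i j assume "i < dim_row (0\<^sub>m (dim_row A) (dim_col A) :: 'a mat)"
    and "j < dim_col (0\<^sub>m (dim_row A) (dim_col A) :: 'a mat)"
  then have i: "i < dim_row A" and j: "j < dim_col A" by auto
  have "col A j \<bullet>c col A j = (mat_adjoint A * A) $$ (j, j)"
    using j by (auto simp: scalar_prod_def mat_adjoint_index mult.commute intro!: sum.cong)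
  also have "\<dots> = 0" using assms j by simp
  finally have "col A j = 0\<^sub>v (dim_row A)"
    using conjugate_square_eq_0_vec[of "col A j" "dim_row A"] by simp
  then have "col A j $ i = 0" using i by simp
  then show "A $$ (i, j) = 0\<^sub>m (dim_row A) (dim_col A) $$ (i, j)"
    using i j by simp
qed auto

text \<open>With \<open>D = M (Y - Z)\<close> the assumption says \<open>M\<^sup>*D = 0\<close>, hence \<open>D\<^sup>*D = (Y - Z)\<^sup>*M\<^sup>*D = 0\<close>.\<close>

lemma adjoint_mult_left_cancel:
  fixes M :: "'a :: conjugatable_ordered_field mat"
  assumes M: "M \<in> carrier_mat q p" and Y: "Y \<in> carrier_mat p r" and Z: "Z \<in> carrier_mat p r"
    and eq: "mat_adjoint M * (M * Y) = mat_adjoint M * (M * Z)"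
  shows "M * Y = M * Z"
proof -
  define D where "D = M * Y - M * Z"
  have D: "D \<in> carrier_mat q r" using M Y Z by (auto simp: D_def)
  have D': "D = M * (Y - Z)" using M Y Z by (simp add: D_def mult_minus_distrib_mat)
  have "mat_adjoint M * D = mat_adjoint M * (M * Y) - mat_adjoint M * (M * Z)"
    unfolding D_def
    by (rule mult_minus_distrib_mat[of _ p q _ r]) (use M Y Z in auto)
  also have "\<dots> = 0\<^sub>m p r" unfolding eq
    by (rule minus_r_inv_mat) (use M Z in auto)
  finally have "mat_adjoint M * D = 0\<^sub>m p r" .
  moreover have "mat_adjoint D = mat_adjoint (Y - Z) * mat_adjoint M"
    unfolding D' by (rule mat_adjoint_mult) (use M Y Z in auto)
  ultimately have "mat_adjoint D * D = mat_adjoint (Y - Z) * 0\<^sub>m p r"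
    using M D Y Z by (simp add: mat_mult_assoc)
  also have "\<dots> = 0\<^sub>m (dim_col D) (dim_col D)"
    using Y Z D by (auto intro!: right_mult_zero_mat)
  finally have "D = 0\<^sub>m q r" using adjoint_mult_self_eq_0D[of D] D by auto
  then have 0: "M * Y - M * Z = 0\<^sub>m q r" by (simp add: D_def)
  show ?thesis
  proof (rule eq_matI)
    fix i j assume "i < dim_row (M * Z)" "j < dim_col (M * Z)"
    then have ij: "i < q" "j < r" using M Z by auto
    have "(M * Y - M * Z) $$ (i, j) = 0" unfolding 0 using ij by simp
    then show "(M * Y) $$ (i, j) = (M * Z) $$ (i, j)"
      using ij M Y Z by (simp del: index_mult_mat(1))
  qed (use M Y Z in auto)
qed

section \<open>The pseudoinverse exists and is unique\<close>

text \<open>In a reduced echelon form the pivot column of row \<open>k\<close> is the unit vector \<open>e\<^sub>k\<close>. Let \<open>E\<close> select the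
  pivot columns: \<open>C * E\<close> is then the diagonal projection onto the coordinates of the nonzero rows,
  and it fixes \<open>C\<close>.\<close>

lemma echelon_inner_inverse:
  fixes C :: "'a :: semiring_1 mat"
  assumes C: "C \<in> carrier_mat nr nc" and "row_echelon_form C"
  shows "\<exists>E. E \<in> carrier_mat nc nr \<and> C * E * C = C"
proof -
  obtain f where "pivot_fun C f nc" using assms by (auto simp: row_echelon_form_def)
  note piv = pivot_funD[OF _ this, of nr]
  \<comment> \<open>A zero row \<open>i\<close> is marked by \<open>f i = nc\<close>; the corresponding column of \<open>E\<close> is zero.\<close>
  define E :: "'a mat" where "E = mat nc nr (\<lambda>(j, i). if f i = j then 1 else 0)"
  have CE: "(C * E) $$ (i, k) = (if i = k \<and> f k < nc then 1 else 0)" if "i < nr" "k < nr" for i k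
  proof -
    have "(C * E) $$ (i, k) = (\<Sum>j = 0..<nc. C $$ (i, j) * (if f k = j then 1 else 0))"
      using C that by (auto simp: E_def scalar_prod_def intro!: sum.cong)
    also have "\<dots> = (if f k < nc then C $$ (i, f k) else 0)"
      by (auto simp: if_distrib[of "\<lambda>x. _ * x"] cong: if_cong)
    also have "\<dots> = (if i = k \<and> f k < nc then 1 else 0)"
      using piv(4,5) C that by auto
    finally show ?thesis .
  qed
  have "C * E * C = C"
  proof (rule eq_matI)
    fix i l assume "i < dim_row C" "l < dim_col C"
    then have il: "i < nr" "l < nc" using C by auto
    have "(C * E * C) $$ (i, l) = row (C * E) i \<bullet> col C l"
      using C il by (intro index_mult_mat(1)) (auto simp: E_def)
    also have "\<dots> = (\<Sum>k = 0..<nr. (C * E) $$ (i, k) * C $$ (k, l))"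
      unfolding scalar_prod_def using C il
      by (intro sum.cong) (auto simp: E_def simp del: index_mult_mat(1))
    also have "\<dots> = (\<Sum>k = 0..<nr. if i = k then (if f i < nc then C $$ (i, l) else 0) else 0)"
      using il by (intro sum.cong) (auto simp: CE)
    also have "\<dots> = (if f i < nc then C $$ (i, l) else 0)" using il by simp
    also have "\<dots> = C $$ (i, l)"
      using piv(1)[of i] piv(2)[of i l] il C by (auto simp: not_less)
    finally show "(C * E * C) $$ (i, l) = C $$ (i, l)" .
  qed (use C in \<open>auto simp: E_def\<close>)
  then show ?thesis by (intro exI[of _ E]) (auto simp: E_def)
qed

text \<open>If \<open>P\<close> is the invertible matrix of the row operations that bring \<open>A\<close> to echelon form \<open>C\<close>, then an
  inner inverse \<open>E\<close> of \<open>C\<close> pulls back to the inner inverse \<open>E * P\<close> of \<open>A\<close>.\<close>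

lemma inner_inverse_exists:
  fixes A :: "'a :: field mat"
  assumes A: "A \<in> carrier_mat nr nc"
  shows "\<exists>G. G \<in> carrier_mat nc nr \<and> A * G * A = A"
proof -
  define C where "C = gauss_jordan_single A"
  note gj = gauss_jordan_single[OF A C_def[symmetric]]
  obtain P Q where PQ: "C = P * A" "P \<in> carrier_mat nr nr" "Q \<in> carrier_mat nr nr"
    "Q * P = 1\<^sub>m nr" using gj(4) by blast
  obtain E where E: "E \<in> carrier_mat nc nr" "C * E * C = C"
    using echelon_inner_inverse[OF gj(2,3)] by blast
  note [simp] = carrier_matD[OF A] carrier_matD[OF PQ(2)] carrier_matD[OF PQ(3)] carrier_matD[OF E(1)]
  have AQC: "Q * C = A"
  proof -
    have "Q * C = Q * P * A" by (simp add: PQ(1) mat_mult_assoc)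
    then show ?thesis using A by (simp add: PQ(4))
  qed
  have "A * (E * P) * A = Q * (C * E * C)"
    by (subst AQC[symmetric]) (simp add: PQ(1) mat_mult_assoc)
  also have "\<dots> = A" by (simp only: E(2) AQC)
  finally show ?thesis using PQ E by (intro exI[of _ "E * P"]) auto
qed

text \<open>The witness is \<open>Y = G M\<^sup>*\<close> for an inner inverse \<open>G\<close> of \<open>M\<^sup>*M\<close>; cancelling the leftmost \<open>M\<^sup>*\<close> in
  \<open>M\<^sup>*M G M\<^sup>*M = M\<^sup>*M\<close> shows that it is an inner inverse of \<open>M\<close>. Geometrically \<open>M Y\<close> is the
  orthogonal projection onto the range of \<open>M\<close>.\<close>

lemma hermitian_inner_inverse_exists:
  fixes M :: "'a :: conjugatable_ordered_field mat"
  assumes M: "M \<in> carrier_mat q p"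
  shows "\<exists>Y. Y \<in> carrier_mat p q \<and> M * Y * M = M \<and> mat_adjoint (M * Y) = M * Y"
proof -
  let ?H = "mat_adjoint M"
  have "?H * M \<in> carrier_mat p p" using M by auto
  then obtain G where G: "G \<in> carrier_mat p p" "?H * M * G * (?H * M) = ?H * M"
    using inner_inverse_exists by blast
  note [simp] = carrier_matD[OF M] carrier_matD[OF G(1)]
  have "M * (G * (?H * M)) = M * 1\<^sub>m p"
  proof (rule adjoint_mult_left_cancel[OF M, of _ p])
    show "?H * (M * (G * (?H * M))) = ?H * (M * 1\<^sub>m p)"
      using G(2) M by (simp add: mat_mult_assoc)
  qed (rule carrier_matI; simp)+
  then have inner: "M * G * ?H * M = M" using M by (simp add: mat_mult_assoc)
  define W where "W = M * G * ?H"
  have W: "dim_row W = q" "dim_col W = q" by (auto simp: W_def)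
  \<comment> \<open>\<open>W\<close> is Hermitian because it equals \<open>W * W\<^sup>*\<close>, by the adjoint of \<open>W * M = M\<close>.\<close>
  have "W * mat_adjoint W = M * G * (?H * mat_adjoint W)"
    by (simp add: W_def mat_mult_assoc mat_adjoint_mult)
  also have "?H * mat_adjoint W = mat_adjoint (W * M)"
    by (rule mat_adjoint_mult[symmetric]) (simp add: W)
  also have "W * M = M" using inner by (simp add: W_def)
  finally have WW: "W * mat_adjoint W = W" by (simp add: W_def)
  have "mat_adjoint W = mat_adjoint (W * mat_adjoint W)" by (simp only: WW)
  also have "\<dots> = W * mat_adjoint W" by (subst mat_adjoint_mult) (auto simp: W)
  finally have herm: "mat_adjoint W = W" using WW by simp
  have MY: "M * (G * ?H) = W" by (simp add: W_def mat_mult_assoc)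
  show ?thesis
  proof (intro exI conjI)
    show "G * ?H \<in> carrier_mat p q" by (rule carrier_matI) simp_all
    show "M * (G * ?H) * M = M" unfolding MY using inner by (simp add: W_def)
    show "mat_adjoint (M * (G * ?H)) = M * (G * ?H)" unfolding MY by (rule herm)
  qed
qed

text \<open>Apply the previous construction to \<open>M\<close>, giving \<open>Y\<close> with \<open>M Y\<close> Hermitian, and to \<open>M\<^sup>*\<close>, whose
  result has an adjoint \<open>V\<close> with \<open>V M\<close> Hermitian. The product \<open>V M Y\<close> inherits both symmetries,
  since \<open>M (V M Y) = M Y\<close> and \<open>(V M Y) M = V M\<close>.\<close>

lemma pseudoinverse_exists:
  fixes M :: "'a :: conjugatable_ordered_field mat"
  shows "\<exists>X. is_pseudoinverse M X"
proof -
  define q p where "q = dim_row M" and "p = dim_col M"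
  have M: "M \<in> carrier_mat q p" by (auto simp: q_def p_def)
  obtain Y where Y: "Y \<in> carrier_mat p q" "M * Y * M = M" "mat_adjoint (M * Y) = M * Y"
    using hermitian_inner_inverse_exists[OF M] by blast
  have "mat_adjoint M \<in> carrier_mat p q" using M by simp
  then obtain Z where Z: "Z \<in> carrier_mat q p" "mat_adjoint M * Z * mat_adjoint M = mat_adjoint M"
    "mat_adjoint (mat_adjoint M * Z) = mat_adjoint M * Z"
    using hermitian_inner_inverse_exists by blast
  define V where "V = mat_adjoint Z"
  note [simp] = carrier_matD[OF M] carrier_matD[OF Y(1)] carrier_matD[OF Z(1)]
  have V: "V \<in> carrier_mat p q" using Z by (simp add: V_def)
  note [simp] = carrier_matD[OF V]
  have MVM: "M * V * M = M"
    using arg_cong[OF Z(2), of mat_adjoint] by (simp add: mat_adjoint_mult V_def mat_mult_assoc)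
  have VM: "mat_adjoint (V * M) = V * M"
    using Z(3) by (simp add: mat_adjoint_mult V_def)
  define X where "X = V * M * Y"
  have MX: "M * X = M * Y"
    using arg_cong[OF MVM, of "\<lambda>T. T * Y"] by (simp add: X_def mat_mult_assoc)
  have XM: "X * M = V * M"
    using arg_cong[OF Y(2), of "\<lambda>T. V * T"] by (simp add: X_def mat_mult_assoc)
  have "X * M * X = V * M * V * M * Y" unfolding XM by (simp add: X_def mat_mult_assoc)
  also have "\<dots> = V * (M * V * M) * Y" by (simp add: mat_mult_assoc)
  also have "\<dots> = X" by (simp add: MVM X_def)
  finally have "X * M * X = X" .
  then have "is_pseudoinverse M X"
    unfolding is_pseudoinverse_def using MX XM Y VM by (auto simp: X_def)
  then show ?thesis by blast
qed

text \<open>Both \<open>M X\<close> and \<open>M Y\<close> are Hermitian and each fixes \<open>M\<close>, so taking the adjoint of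
  \<open>M X = (M Y) (M X)\<close> yields \<open>M X = (M X) (M Y) = M Y\<close>; likewise \<open>X M = Y M\<close>. Then
  \<open>X = X M X = Y M X = Y M Y = Y\<close>.\<close>

lemma pseudoinverse_unique:
  fixes M :: "'a :: conjugatable_field mat"
  assumes X: "is_pseudoinverse M X" and Y: "is_pseudoinverse M Y"
  shows "X = Y"
proof -
  define q p where "q = dim_row M" and "p = dim_col M"
  note x = X[unfolded is_pseudoinverse_def] and y = Y[unfolded is_pseudoinverse_def]
  have [simp]: "dim_row X = p" "dim_col X = q" "dim_row Y = p" "dim_col Y = q"
    "dim_row M = q" "dim_col M = p"
    using x y by (auto simp: q_def p_def)
  have "M * X = mat_adjoint (M * Y * M * X)" using x y by simp
  also have "\<dots> = mat_adjoint ((M * Y) * (M * X))" by (simp add: mat_mult_assoc)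
  also have "\<dots> = mat_adjoint (M * X) * mat_adjoint (M * Y)" by (rule mat_adjoint_mult) simp
  also have "\<dots> = (M * X) * (M * Y)" using x y by simp
  also have "\<dots> = M * X * M * Y" by (simp add: mat_mult_assoc)
  also have "\<dots> = M * Y" using x by simp
  finally have MX: "M * X = M * Y" .
  have "X * M = mat_adjoint (X * (M * Y * M))" using x y by simp
  also have "\<dots> = mat_adjoint ((X * M) * (Y * M))" by (simp add: mat_mult_assoc)
  also have "\<dots> = mat_adjoint (Y * M) * mat_adjoint (X * M)" by (rule mat_adjoint_mult) simp
  also have "\<dots> = (Y * M) * (X * M)" using x y by simp
  also have "\<dots> = Y * (M * X * M)" by (simp add: mat_mult_assoc)
  also have "\<dots> = Y * M" using x by simp
  finally have XM: "X * M = Y * M" .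
  have "X = X * M * X" using x by simp
  also have "\<dots> = Y * (M * X)" by (simp add: XM mat_mult_assoc)
  also have "\<dots> = Y * M * Y" by (simp add: MX mat_mult_assoc)
  also have "\<dots> = Y" using y by simp
  finally show ?thesis .
qed

lemma pseudoinverse_is_pseudoinverse:
  fixes M :: "'a :: conjugatable_ordered_field mat"
  shows "is_pseudoinverse M (pseudoinverse M)"
  unfolding pseudoinverse_def
  using pseudoinverse_exists[of M] by (auto intro: theI pseudoinverse_unique)

section \<open>Ranges, kernels and ranks of products\<close>

lemma col_space_image:
  fixes A :: "'a :: field mat"
  assumes A: "A \<in> carrier_mat n k"
  shows "vec_space.col_space n A = (*\<^sub>v) A ` carrier_vec k"
proof (rule Set.set_eqI)
  fix y
  have "y \<in> vec_space.col_space n A \<longleftrightarrow> y \<in> carrier_vec n \<and> (\<exists>x \<in> carrier_vec k. A *\<^sub>v x = y)"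
    using A by (subst vec_space.col_space_eq[OF A]) simp
  also have "\<dots> \<longleftrightarrow> y \<in> (*\<^sub>v) A ` carrier_vec k"
    using mult_mat_vec_carrier[OF A] by blast
  finally show "y \<in> vec_space.col_space n A \<longleftrightarrow> y \<in> (*\<^sub>v) A ` carrier_vec k" .
qed

lemma col_space_mult_subset:
  fixes A :: "'a :: field mat"
  assumes A: "A \<in> carrier_mat n k" and C: "C \<in> carrier_mat k l"
  shows "vec_space.col_space n (A * C) \<subseteq> vec_space.col_space n A"
proof -
  have "(*\<^sub>v) (A * C) ` carrier_vec l \<subseteq> (*\<^sub>v) A ` carrier_vec k"
  proof (rule image_subsetI)
    fix x :: "'a vec" assume x: "x \<in> carrier_vec l"
    have "A * C *\<^sub>v x = A *\<^sub>v (C *\<^sub>v x)" using A C x by (rule assoc_mult_mat_vec)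
    then show "A * C *\<^sub>v x \<in> (*\<^sub>v) A ` carrier_vec k"
      using mult_mat_vec_carrier[OF C x] by simp
  qed
  then show ?thesis
    by (simp only: col_space_image[OF A] col_space_image[OF mult_carrier_mat[OF A C]])
qed

lemma col_space_eqI:
  fixes A B :: "'a :: field mat"
  assumes "A \<in> carrier_mat n k" "B \<in> carrier_mat n l" "C \<in> carrier_mat l k" "D \<in> carrier_mat k l"
    and "A = B * C" "B = A * D"
  shows "vec_space.col_space n A = vec_space.col_space n B"
proof (rule subset_antisym)
  show "vec_space.col_space n A \<subseteq> vec_space.col_space n B"
    using col_space_mult_subset[OF assms(2,3)] unfolding assms(5)[symmetric] .
  show "vec_space.col_space n B \<subseteq> vec_space.col_space n A"
    using col_space_mult_subset[OF assms(1,4)] unfolding assms(6)[symmetric] .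
qed

lemma rank_cong_col_space:
  fixes A B :: "'a :: field mat"
  assumes "vec_space.col_space n A = vec_space.col_space n B"
  shows "vec_space.rank n A = vec_space.rank n B"
  using assms by (simp add: vec_space.rank_def vec_space.col_space_def)

text \<open>Left multiplication by \<open>T\<close> is a linear map from the column space of \<open>A\<close> onto that of \<open>T * A\<close>, so
  the bound is the rank-nullity theorem with the dimension of the kernel dropped.\<close>

lemma rank_mult_le_right:
  fixes A T :: "'a :: field mat"
  assumes T: "T \<in> carrier_mat q n" and A: "A \<in> carrier_mat n k"
  shows "vec_space.rank q (T * A) \<le> vec_space.rank n A"
proof -
  interpret V: vec_space "TYPE('a)" n .
  interpret W: vec_space "TYPE('a)" q .
  let ?S = "V.col_space A"
  have cols: "set (cols A) \<subseteq> carrier_vec n" using A cols_dim by blast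
  note S = col_space_image[OF A]
  have vs: "vectorspace class_ring (V.vs ?S)"
    unfolding V.col_space_def using V.span_is_subspace V.subspace_is_vs cols by simp
  interpret lm: linear_map class_ring "V.vs ?S" "module_vec TYPE('a) q" "\<lambda>v. T *\<^sub>v v"
  proof (intro linear_map.intro mod_hom.intro mod_hom_axioms.intro)
    show "vectorspace class_ring (V.vs ?S)" by (rule vs)
    then show "Module.module class_ring (V.vs ?S)" by (rule vectorspace.axioms(1))
    show "vectorspace class_ring (module_vec TYPE('a) q)" by (rule W.vectorspace_axioms)
    show "Module.module class_ring (module_vec TYPE('a) q)" by (rule W.module_axioms)
    have "?S \<subseteq> carrier_vec n" unfolding S using A by auto
    then show "(\<lambda>v. T *\<^sub>v v) \<in> LinearCombinations.module_hom class_ring (V.vs ?S) (module_vec TYPE('a) q)"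
      using T by (auto simp: LinearCombinations.module_hom_def module_vec_simps mult_add_distrib_mat_vec[OF T]
          mult_mat_vec[OF T] subset_iff)
  qed
  have "lm.imT = (\<lambda>x. T *\<^sub>v (A *\<^sub>v x)) ` carrier_vec k"
    unfolding lm.im_def by (simp add: S image_image)
  also have "\<dots> = (*\<^sub>v) (T * A) ` carrier_vec k"
    by (intro image_cong refl assoc_mult_mat_vec[OF T A, symmetric])
  also have "\<dots> = W.col_space (T * A)"
    by (rule col_space_image[OF mult_carrier_mat[OF T A], symmetric])
  finally have im: "lm.imT = W.col_space (T * A)" .
  have "V.vs ?S = V.span_vs (set (cols A))" by (simp add: V.col_space_def)
  moreover have "vectorspace.fin_dim class_ring (V.vs ?S)"
    unfolding V.col_space_def by (rule V.fin_dim_span_cols[OF A])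
  ultimately show ?thesis
    using lm.rank_nullity unfolding V.rank_def W.rank_def im W.col_space_def by simp
qed

lemma mat_kernel_eqI:
  fixes A B :: "'a :: comm_ring_1 mat"
  assumes "A \<in> carrier_mat k n" "B \<in> carrier_mat l n" "C \<in> carrier_mat k l" "D \<in> carrier_mat l k"
    and "A = C * B" "B = D * A"
  shows "mat_kernel A = mat_kernel B"
proof (rule subset_antisym)
  show "mat_kernel A \<subseteq> mat_kernel B"
    using mat_kernel_mult_subset[OF assms(1,4)] unfolding assms(6)[symmetric] .
  show "mat_kernel B \<subseteq> mat_kernel A"
    using mat_kernel_mult_subset[OF assms(2,3)] unfolding assms(5)[symmetric] .
qed

section \<open>The projection\<close>

text \<open>The theorem over an arbitrary field with a definite conjugation, so that the real and the complex
  case are both instances.\<close>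

lemma pseudoinverse_projection:
  fixes A B :: "'a :: conjugatable_ordered_field mat"
  assumes A: "A \<in> carrier_mat m p" and B: "B \<in> carrier_mat m q"
    and P_def: "P = A * pseudoinverse (mat_adjoint B * A) * mat_adjoint B"
  shows "is_projection P"
    and "vec_space.rank m P = vec_space.rank q (mat_adjoint B * A)"
    and "vec_space.col_space m P = vec_space.col_space m (A * mat_adjoint A * B)"
    and "mat_kernel P = mat_kernel (mat_adjoint A * B * mat_adjoint B)"
proof -
  define M where "M = mat_adjoint B * A"
  define X where "X = pseudoinverse M"
  let ?As = "mat_adjoint A" and ?Bs = "mat_adjoint B"
  let ?Ms = "mat_adjoint M" and ?Xs = "mat_adjoint X"
  have M: "M \<in> carrier_mat q p" using A B by (simp add: M_def)
  have pen: "X \<in> carrier_mat p q" "M * X * M = M" "X * M * X = X"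
    "mat_adjoint (M * X) = M * X" "mat_adjoint (X * M) = X * M"
    using pseudoinverse_is_pseudoinverse[of M] M by (auto simp: is_pseudoinverse_def X_def)
  note X = pen(1)
  note [simp] = carrier_matD[OF A] carrier_matD[OF B] carrier_matD[OF X] carrier_matD[OF M]
  note car = A B X M
  have P: "P = A * X * ?Bs" by (simp add: P_def X_def M_def)
  have Pcar: "P \<in> carrier_mat m m" using car by (simp add: P)
  note [simp] = carrier_matD[OF Pcar]
  have PA: "P * A = A * X * M" by (simp add: P M_def mat_mult_assoc)
  have BsP: "?Bs * P = M * (X * ?Bs)" by (simp add: P M_def mat_mult_assoc)
  have XMX: "A * X * M * (X * ?Bs) = P"
  proof -
    have "A * X * M * (X * ?Bs) = A * (X * M * X) * ?Bs" by (simp add: mat_mult_assoc)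
    then show ?thesis by (simp add: pen(3) P)
  qed
  have "P * P = P * A * (X * ?Bs)" by (subst (2) P) (simp add: mat_mult_assoc)
  then have "P * P = P" by (simp add: PA XMX)
  then show "is_projection P" by (simp add: is_projection_def)

  \<comment> \<open>The range of \<open>M\<close> is that of \<open>B\<^sup>* * P\<close>, and the range of \<open>P\<close> is that of \<open>A * X * M\<close>.\<close>
  have BsPA: "?Bs * P * A = M"
  proof -
    have "?Bs * P * A = M * X * M" by (simp add: P M_def mat_mult_assoc)
    then show ?thesis by (simp add: pen(2))
  qed
  have "vec_space.rank q M = vec_space.rank q (?Bs * P)"
    by (rule rank_cong_col_space, rule col_space_eqI[of _ _ p _ m A "X * ?Bs"])
      (rule BsPA[symmetric] BsP carrier_matI | simp)+
  also have "\<dots> \<le> vec_space.rank m P"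
    by (rule rank_mult_le_right[of _ _ m _ m]) (rule carrier_matI | simp)+
  finally have le: "vec_space.rank q M \<le> vec_space.rank m P" .
  have "vec_space.rank m P = vec_space.rank m (A * X * M)"
    by (rule rank_cong_col_space, rule col_space_eqI[of _ _ m _ p "X * ?Bs" A])
      (rule XMX[symmetric] PA[symmetric] carrier_matI | simp)+
  also have "\<dots> \<le> vec_space.rank q M"
    by (rule rank_mult_le_right[of _ _ q _ p]) (rule carrier_matI | simp)+
  finally show "vec_space.rank m P = vec_space.rank q (?Bs * A)"
    using le by (simp add: M_def)

  have XM: "?Ms * ?Xs = X * M" using pen(5) by (simp add: mat_adjoint_mult)
  have MX: "?Xs * ?Ms = M * X" using pen(4) by (simp add: mat_adjoint_mult)
  have Ms1: "X * M * ?Ms = ?Ms"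
  proof -
    have "?Ms = mat_adjoint (M * (X * M))" using pen(2) by (simp add: mat_mult_assoc)
    also have "\<dots> = mat_adjoint (X * M) * ?Ms" by (rule mat_adjoint_mult) simp
    finally show ?thesis by (simp only: pen(5))
  qed
  have Ms2: "?Ms * (M * X) = ?Ms"
  proof -
    have "?Ms = mat_adjoint (M * X * M)" by (simp only: pen(2))
    also have "\<dots> = ?Ms * mat_adjoint (M * X)" by (rule mat_adjoint_mult) simp
    finally show ?thesis by (simp only: pen(4))
  qed
  have AB: "?As * B = ?Ms" by (simp add: M_def mat_adjoint_mult)

  \<comment> \<open>\<open>P\<close> and \<open>A * M\<^sup>*\<close> are right multiples of each other, so their ranges agree.\<close>
  have PK: "P = A * ?Ms * (?Xs * X * ?Bs)"
  proof -
    have "A * ?Ms * (?Xs * X * ?Bs) = A * (?Ms * ?Xs) * (X * ?Bs)" by (simp add: mat_mult_assoc)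
    then show ?thesis by (simp add: XM XMX[symmetric] mat_mult_assoc)
  qed
  have KP: "A * ?Ms = P * (A * ?Ms)"
  proof -
    have "P * (A * ?Ms) = A * (X * M * ?Ms)" by (simp add: P M_def mat_mult_assoc)
    then show ?thesis by (simp add: Ms1)
  qed
  have "vec_space.col_space m P = vec_space.col_space m (A * ?Ms)"
    by (rule col_space_eqI[OF _ _ _ _ PK KP, of m m q]) (rule carrier_matI | simp)+
  then show "vec_space.col_space m P = vec_space.col_space m (A * ?As * B)"
    by (simp add: AB mat_mult_assoc)

  \<comment> \<open>\<open>P\<close> and \<open>M\<^sup>* * B\<^sup>*\<close> are left multiples of each other, so their kernels agree.\<close>
  have PL: "P = A * X * ?Xs * (?Ms * ?Bs)"
  proof -
    have "A * X * ?Xs * (?Ms * ?Bs) = A * X * (?Xs * ?Ms) * ?Bs" by (simp add: mat_mult_assoc)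
    then show ?thesis by (simp add: MX XMX[symmetric] mat_mult_assoc)
  qed
  have LP: "?Ms * ?Bs = ?Ms * ?Bs * P"
  proof -
    have "?Ms * ?Bs * P = ?Ms * (M * X) * ?Bs" by (simp add: P M_def mat_mult_assoc)
    then show ?thesis by (simp add: Ms2)
  qed
  have "mat_kernel P = mat_kernel (?Ms * ?Bs)"
    by (rule mat_kernel_eqI[OF _ _ _ _ PL LP, of m m p]) (rule carrier_matI | simp)+
  then show "mat_kernel P = mat_kernel (?As * B * ?Bs)"
    by (simp add: AB)
qed

theorem lemma4p2:
  fixes m p q :: nat
  shows
    "(\<forall>(A :: real mat) (B :: real mat) P.
        A \<in> carrier_mat m p \<longrightarrow> B \<in> carrier_mat m q \<longrightarrow>
        P = A * pseudoinverse (mat_adjoint B * A) * mat_adjoint B \<longrightarrow>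
          is_projection P \<and>
          vec_space.rank m P = vec_space.rank q (mat_adjoint B * A) \<and>
          vec_space.col_space m P = vec_space.col_space m (A * mat_adjoint A * B) \<and>
          mat_kernel P = mat_kernel (mat_adjoint A * B * mat_adjoint B)) \<and>
     (\<forall>(A :: complex mat) (B :: complex mat) P.
        A \<in> carrier_mat m p \<longrightarrow> B \<in> carrier_mat m q \<longrightarrow>
        P = A * pseudoinverse (mat_adjoint B * A) * mat_adjoint B \<longrightarrow>
          is_projection P \<and>
          vec_space.rank m P = vec_space.rank q (mat_adjoint B * A) \<and>
          vec_space.col_space m P = vec_space.col_space m (A * mat_adjoint A * B) \<and>
          mat_kernel P = mat_kernel (mat_adjoint A * B * mat_adjoint B))"
  by (intro conjI allI impI; rule pseudoinverse_projection; assumption)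

end
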